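(* Let $p\in(0,1)$ and let $(A,B)$ be the random vector with $$(A,B)\overset{d}{=}I_p(1-L,0)+(1-I_p)(1,R),$$ where $I_p\sim Be(p)$, $L=1-p$ and $R=p$. Suppose $V_2\sim\Gamma_1$. Then $V_1\sim\Gamma_1$ is the unique (in distribution) solution to $$V_1\overset{d}{=}AV_1+BV_2,\qquad V_1,V_2,(A,B)\text{ mutually independent}.$$
   Context: $\overset{d}{=}$ denotes equality in distribution. $Be(p)$ is the Bernoulli distribution with success probability $p$. $\Gamma_a$, $a>0$, is the gamma distribution with shape $a$ and scale $1$ (so $\Gamma_1$ is the standard exponential distribution). A solution of the random equation is a real random variable (or its law) satisfying it; uniqueness is in distribution. *)

theory Defs
  imports "HOL-Probability.Probability"
begin

definition gamma_distr :: "real \<Rightarrow> real measure" where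
  "gamma_distr a =
     density lborel (\<lambda>x. ennreal (if x > 0 then x powr (a - 1) * exp (- x) / Gamma a else 0))"

lemma gamma_distr_1: "gamma_distr 1 = density lborel (exponential_density 1)"
proof -
  have "AE x in lborel. (if x > 0 then x powr (1 - 1) * exp (- x) / Gamma 1 else (0::real)) =
          exponential_density 1 x"
    using AE_lborel_singleton[of "0::real"]
    by eventually_elim (auto simp: exponential_density_def)
  then show ?thesis
    unfolding gamma_distr_def by (intro density_cong) (auto elim: eventually_mono)
qed

text \<open>Equality in distribution of two random variables, possibly on different probability spaces.\<close>

definition eq_in_distr ::
  "'a measure \<Rightarrow> ('a \<Rightarrow> 'c::topological_space) \<Rightarrow> 'b measure \<Rightarrow> ('b \<Rightarrow> 'c) \<Rightarrow> bool" where
  "eq_in_distr M X N Y \<longleftrightarrow> X \<in> borel_measurable M \<and> Y \<in> borel_measurable N \<and>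
     distr M borel X = distr N borel Y"

text \<open>
  Mutual independence of three Borel random variables. The library's \<open>indep_vars\<close> requires all
  members of the family to take values in the same type; this is its definition (independence of
  the generated sigma-algebras), written out for three variables with possibly different types.
\<close>

definition (in prob_space) indep_var3 ::
  "('a \<Rightarrow> 'b::topological_space) \<Rightarrow> ('a \<Rightarrow> 'c::topological_space) \<Rightarrow>
   ('a \<Rightarrow> 'd::topological_space) \<Rightarrow> bool" where
  "indep_var3 X Y Z \<longleftrightarrow>
     random_variable borel X \<and> random_variable borel Y \<and> random_variable borel Z \<and>
     indep_sets (\<lambda>i::nat.
         if i = 0 then {X -` S \<inter> space M | S. S \<in> sets borel}
         else if i = 1 then {Y -` S \<inter> space M | S. S \<in> sets borel}
         else {Z -` S \<inter> space M | S. S \<in> sets borel}) {0, 1, 2}"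

text \<open>The vector \<open>I\<^sub>p (1 - L, 0) + (1 - I\<^sub>p) (1, R)\<close> as a function of the value of \<open>I\<^sub>p\<close>.\<close>

definition mixed_coeffs :: "real \<Rightarrow> real \<Rightarrow> bool \<Rightarrow> real \<times> real" where
  "mixed_coeffs L R i = of_bool i *\<^sub>R (1 - L, 0) + (1 - of_bool i) *\<^sub>R (1, R)"

text \<open>
  The data of the random equation on a probability space \<open>M\<close>: everything except the equation
  itself. Nothing is assumed about the law of \<open>V1\<close>.
\<close>

definition rde_setting ::
  "real \<Rightarrow> 'a measure \<Rightarrow> ('a \<Rightarrow> real) \<Rightarrow> ('a \<Rightarrow> real) \<Rightarrow> ('a \<Rightarrow> real) \<Rightarrow> ('a \<Rightarrow> real) \<Rightarrow> bool" where
  "rde_setting p M V1 V2 A B \<longleftrightarrow>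
     prob_space M \<and>
     prob_space.indep_var3 M V1 V2 (\<lambda>\<omega>. (A \<omega>, B \<omega>)) \<and>
     distr M borel V2 = gamma_distr 1 \<and>
     eq_in_distr M (\<lambda>\<omega>. (A \<omega>, B \<omega>)) (measure_pmf (bernoulli_pmf p)) (mixed_coeffs (1 - p) p)"

definition rde_solution ::
  "real \<Rightarrow> 'a measure \<Rightarrow> ('a \<Rightarrow> real) \<Rightarrow> ('a \<Rightarrow> real) \<Rightarrow> ('a \<Rightarrow> real) \<Rightarrow> ('a \<Rightarrow> real) \<Rightarrow> bool" where
  "rde_solution p M V1 V2 A B \<longleftrightarrow>
     rde_setting p M V1 V2 A B \<and>
     eq_in_distr M V1 M (\<lambda>\<omega>. A \<omega> * V1 \<omega> + B \<omega> * V2 \<omega>)"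

end

theory Submission
  imports Defs
begin

text \<open>
  Conditioning on \<open>(A, B)\<close>, which is \<open>(p, 0)\<close> with probability \<open>p\<close> and \<open>(1, p)\<close> otherwise, turns
  the equation into \<open>\<phi>(t) = p \<phi>(p t) + (1 - p) \<phi>(t) / (1 - \<i> p t)\<close> for the characteristic
  function \<open>\<phi>\<close> of \<open>V1\<close>. Clearing the denominator, this says that \<open>g(t) = (1 - \<i> t) \<phi>(t)\<close> satisfies
  \<open>g(t) = g(p t)\<close>. Since \<open>g\<close> is continuous at 0 and \<open>p^n t\<close> tends to 0, this holds iff \<open>g\<close> is
  constantly \<open>g(0) = 1\<close>, i.e. iff \<open>\<phi>\<close> is the characteristic function of the exponential law.
\<close>

section \<open>The standard exponential law and its characteristic function\<close>

lemma prob_space_gamma_distr_1: "prob_space (gamma_distr 1)"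
  unfolding gamma_distr_1 by (rule prob_space_exponential_density) simp

lemma real_distribution_gamma_distr_1: "real_distribution (gamma_distr 1)"
  using prob_space_gamma_distr_1
  by (simp add: real_distribution_def real_distribution_axioms_def gamma_distr_1)

text \<open>The density defines a probability measure, against which the constant 1 is integrable;
  rewriting this over \<open>lborel\<close> leaves the density itself. It serves as the dominating
  function for the characteristic function integral.\<close>

lemma integrable_exponential_density:
  assumes l: "0 < l"
  shows "integrable lborel (exponential_density l)"
proof -
  interpret prob_space "density lborel (exponential_density l)"
    by (rule prob_space_exponential_density) fact
  have "integrable (density lborel (exponential_density l)) (\<lambda>_. 1 :: real)"
    by simp
  then show ?thesis
    by (subst (asm) integrable_density)
      (use l in \<open>auto intro!: AE_I2 erlang_density_nonneg\<close>)
qed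

text \<open>On the positive half-line the integrand is \<open>exp (w * x)\<close> with
  \<open>w = \<i> * t - 1\<close>. Its antiderivative \<open>exp (w * x) / w\<close> vanishes at
  infinity because \<open>Re w = -1\<close>, so only the boundary term at 0 remains.\<close>

lemma char_gamma_distr_1: "char (gamma_distr 1) t = 1 / (1 - \<i> * t)"
proof -
  define w :: complex where "w = \<i> * t - 1"
  have w: "w \<noteq> 0" "Re w = -1" by (auto simp: w_def complex_eq_iff)
  define f where "f x = exp (w * complex_of_real x)" for x :: real
  have norm_f: "norm (f x) = exp (- x)" for x
    by (simp add: f_def norm_exp_eq_Re w)
  have [measurable]: "f \<in> borel_measurable borel"
    unfolding f_def by measurable
  have int: "set_integrable lborel (einterval 0 \<infinity>) f"
    unfolding set_integrable_def
  proof (rule Bochner_Integration.integrable_bound[OF integrable_exponential_density[of 1]])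
    show "AE x in lborel. norm (indicat_real (einterval 0 \<infinity>) x *\<^sub>R f x)
             \<le> norm (exponential_density 1 x)"
      by (intro AE_I2) (auto simp: norm_f exponential_density_def indicator_def einterval_def zero_ereal_def)
  qed simp_all
  \<comment> \<open>The two terms are the limits of \<open>f x / w\<close> at infinity and at
    0.\<close>
  have "(LBINT x=0..\<infinity>. f x) = 0 - 1 / w"
  proof (rule interval_integral_FTC_integrable[where F = "\<lambda>x. f x / w"])
    show "((\<lambda>x. f x / w) has_vector_derivative f x) (at x)" for x
      unfolding f_def
      by (rule has_vector_derivative_real_field)
        (use w in \<open>auto intro!: derivative_eq_intros\<close>)
    show "isCont f x" for x
      unfolding f_def by (intro continuous_intros)
    show "set_integrable lborel (einterval 0 \<infinity>) f" by (rule int)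
    have "isCont (\<lambda>x. f x / w) 0"
      unfolding f_def by (intro continuous_intros w)
    then have "((\<lambda>x. f x / w) \<longlongrightarrow> f 0 / w) (at_right 0)"
      by (auto simp: isCont_def intro: tendsto_within_subset)
    then show "(((\<lambda>x. f x / w) \<circ> real_of_ereal) \<longlongrightarrow> 1 / w) (at_right 0)"
      by (simp add: zero_ereal_def ereal_tendsto_simps f_def)
    have "((\<lambda>x. norm (f x)) \<longlongrightarrow> 0) at_top"
      unfolding norm_f
      by (rule filterlim_compose[OF exp_at_bot filterlim_uminus_at_bot_at_top])
    then have "(f \<longlongrightarrow> 0) at_top"
      by (rule tendsto_norm_zero_cancel)
    then have "((\<lambda>x. f x / w) \<longlongrightarrow> 0 / w) at_top"
      by (intro tendsto_intros w)
    then show "(((\<lambda>x. f x / w) \<circ> real_of_ereal) \<longlongrightarrow> 0) (at_left \<infinity>)"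
      by (simp add: ereal_tendsto_simps)
  qed simp
  then have LB: "(\<integral>x. indicat_real {0<..} x *\<^sub>R f x \<partial>lborel) = - 1 / w"
    by (simp add: interval_lebesgue_integral_def set_lebesgue_integral_def einterval_def
        zero_ereal_def greaterThan_def)
  have "char (gamma_distr 1) t = (\<integral>x. exponential_density 1 x *\<^sub>R iexp (t * x) \<partial>lborel)"
    unfolding char_def gamma_distr_1
    by (rule integral_density) (auto intro!: AE_I2 erlang_density_nonneg)
  also have "\<dots> = (\<integral>x. indicat_real {0<..} x *\<^sub>R f x \<partial>lborel)"
  \<comment> \<open>The integrands disagree at the single point 0, where the density is 1 but the
    open half-line is left out.\<close>
  proof (rule integral_cong_AE)
    show "AE x in lborel. exponential_density 1 x *\<^sub>R iexp (t * x) = indicat_real {0<..} x *\<^sub>R f x"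
      using AE_lborel_singleton[of "0::real"]
      by eventually_elim
        (auto simp: exponential_density_def f_def w_def indicator_def left_diff_distrib exp_diff
            exp_minus scaleR_conv_of_real exp_of_real field_simps)
  qed simp_all
  also note LB
  also have "- 1 / w = 1 / (1 - \<i> * t)"
    using w by (simp add: w_def field_simps)
  finally show ?thesis .
qed

section \<open>Product formula for three independent variables\<close>

text \<open>A preimage under \<open>k\<close> after \<open>U\<close> is the
  \<open>U\<close>-preimage of a measurable set, so a function of \<open>U\<close> carries no more
  information than \<open>U\<close>. Independence thereby passes to functions of the
  variables.\<close>

lemma vimage_sets_compose_subset:
  assumes "k \<in> measurable N K"
    and "\<And>\<omega>. \<omega> \<in> \<Omega> \<Longrightarrow> U \<omega> \<in> space N"
  shows "{(\<lambda>\<omega>. k (U \<omega>)) -` S \<inter> \<Omega> |S. S \<in> sets K} \<subseteq> {U -` S \<inter> \<Omega> |S. S \<in> sets N}"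
proof safe
  fix S assume "S \<in> sets K"
  then have "k -` S \<inter> space N \<in> sets N"
    by (rule measurable_sets[OF assms(1)])
  then show "\<exists>T. (\<lambda>\<omega>. k (U \<omega>)) -` S \<inter> \<Omega> = U -` T \<inter> \<Omega> \<and> T \<in> sets N"
    using assms(2) by (intro exI[of _ "k -` S \<inter> space N"]) auto
qed

text \<open>Composition with \<open>f\<close>, \<open>g\<close> and \<open>h\<close> moves the
  variables into the common type \<open>complex\<close>, where \<open>indep_vars\<close> and its
  product formula for integrals apply.\<close>

lemma (in prob_space) indep_var3_integral:
  fixes f :: "'b::topological_space \<Rightarrow> complex" and g :: "'c::topological_space \<Rightarrow> complex"
    and h :: "'d::topological_space \<Rightarrow> complex"
  assumes indep: "indep_var3 X Y Z"
    and [measurable]: "f \<in> borel_measurable borel" "g \<in> borel_measurable borel"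
      "h \<in> borel_measurable borel"
    and int: "integrable M (\<lambda>\<omega>. f (X \<omega>))" "integrable M (\<lambda>\<omega>. g (Y \<omega>))"
      "integrable M (\<lambda>\<omega>. h (Z \<omega>))"
  shows "integrable M (\<lambda>\<omega>. f (X \<omega>) * g (Y \<omega>) * h (Z \<omega>))"
    and "(\<integral>\<omega>. f (X \<omega>) * g (Y \<omega>) * h (Z \<omega>) \<partial>M) =
      (\<integral>\<omega>. f (X \<omega>) \<partial>M) * (\<integral>\<omega>. g (Y \<omega>) \<partial>M) * (\<integral>\<omega>. h (Z \<omega>) \<partial>M)"
proof -
  define W where "W i = (if i = 0 then \<lambda>\<omega>. f (X \<omega>) else if i = (1::nat) then \<lambda>\<omega>. g (Y \<omega>)
    else (\<lambda>\<omega>. h (Z \<omega>)))" for i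
  have rv [measurable]: "random_variable borel X" "random_variable borel Y" "random_variable borel Z"
    using indep by (auto simp: indep_var3_def)
  have "indep_vars (\<lambda>_. borel) W {0, 1, 2}"
    unfolding indep_vars_def2
  proof
    show "\<forall>i\<in>{0, 1, 2}. random_variable borel (W i)"
      by (auto simp: W_def)
    have "indep_sets (\<lambda>i::nat.
         if i = 0 then {X -` S \<inter> space M | S. S \<in> sets borel}
         else if i = 1 then {Y -` S \<inter> space M | S. S \<in> sets borel}
         else {Z -` S \<inter> space M | S. S \<in> sets borel}) {0, 1, 2}"
      using indep unfolding indep_var3_def by blast
    then show "indep_sets (\<lambda>i. {W i -` S \<inter> space M |S. S \<in> sets borel}) {0, 1, 2}"
    proof (rule indep_sets_mono_sets)
      fix i :: nat
      show "{W i -` S \<inter> space M |S. S \<in> sets borel} \<subseteq>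
        (if i = 0 then {X -` S \<inter> space M | S. S \<in> sets borel}
         else if i = 1 then {Y -` S \<inter> space M | S. S \<in> sets borel}
         else {Z -` S \<inter> space M | S. S \<in> sets borel})"
        by (cases "i = 0"; cases "i = 1"; simp add: W_def vimage_sets_compose_subset)
    qed
  qed
  moreover have "integrable M (W i)" for i
    using int by (simp add: W_def)
  ultimately show
    "integrable M (\<lambda>\<omega>. f (X \<omega>) * g (Y \<omega>) * h (Z \<omega>))"
    "(\<integral>\<omega>. f (X \<omega>) * g (Y \<omega>) * h (Z \<omega>) \<partial>M) =
      (\<integral>\<omega>. f (X \<omega>) \<partial>M) * (\<integral>\<omega>. g (Y \<omega>) \<partial>M) * (\<integral>\<omega>. h (Z \<omega>) \<partial>M)"
    using indep_vars_integrable[of "{0, 1, 2}" W] indep_vars_lebesgue_integral[of "{0, 1, 2}" W]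
    by (auto simp: W_def mult.assoc)
qed

section \<open>Characteristic function of the right-hand side\<close>

lemma (in prob_space) char_distr:
  "random_variable borel X \<Longrightarrow> char (distr M borel X) t = (\<integral>\<omega>. iexp (t * X \<omega>) \<partial>M)"
  unfolding char_def by (subst integral_distr) auto

lemma mixed_coeffs_simps:
  "mixed_coeffs (1 - p) p True = (p, 0)" "mixed_coeffs (1 - p) p False = (1, p)"
  by (auto simp: mixed_coeffs_def)

text \<open>The exponential is split according to the two atoms of \<open>(A, B)\<close>. The
  indicator of an atom depends on \<open>(A, B)\<close> alone, so independence turns the expectation
  of each summand into a product of characteristic functions and the weight of the atom.\<close>

lemma char_rde_rhs:
  fixes p t :: real
  assumes p: "0 < p" "p < 1" and set: "rde_setting p M V1 V2 A B"
  shows "(\<lambda>\<omega>. A \<omega> * V1 \<omega> + B \<omega> * V2 \<omega>) \<in> borel_measurable M"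
    and "char (distr M borel (\<lambda>\<omega>. A \<omega> * V1 \<omega> + B \<omega> * V2 \<omega>)) t =
      p * char (distr M borel V1) (p * t) +
      (1 - p) * (char (distr M borel V1) t * char (gamma_distr 1) (p * t))"
proof -
  interpret prob_space M using set by (simp add: rde_setting_def)
  let ?AB = "\<lambda>\<omega>. (A \<omega>, B \<omega>)"
  let ?c = "mixed_coeffs (1 - p) p"
  have indep: "indep_var3 V1 V2 ?AB"
    and V2: "distr M borel V2 = gamma_distr 1"
    and AB: "distr M borel ?AB = distr (bernoulli_pmf p) borel ?c"
    using set by (auto simp: rde_setting_def eq_in_distr_def)
  have rv [measurable]: "random_variable borel V1" "random_variable borel V2"
      "random_variable borel ?AB"
    using indep by (auto simp: indep_var3_def)
  have [measurable]: "random_variable borel A" "random_variable borel B"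
    using measurable_compose[OF rv(3) borel_measurable_continuous_onI[OF continuous_on_fst[OF continuous_on_id]]]
      measurable_compose[OF rv(3) borel_measurable_continuous_onI[OF continuous_on_snd[OF continuous_on_id]]]
    by auto
  show meas: "(\<lambda>\<omega>. A \<omega> * V1 \<omega> + B \<omega> * V2 \<omega>) \<in> borel_measurable M"
    by measurable
  \<comment> \<open>The indicator is complex-valued so that it can be the third factor in
    \<open>indep_var3_integral\<close>.\<close>
  define ind :: "real \<times> real \<Rightarrow> real \<times> real \<Rightarrow> complex" where "ind c = indicator {c}" for c
  have [measurable]: "ind c \<in> borel_measurable borel" for c
    unfolding ind_def by measurable
  have int_ind: "integrable M (\<lambda>\<omega>. ind c (?AB \<omega>))" for c
    by (rule integrable_const_bound[where B = 1]) (auto simp: ind_def indicator_def)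
  have E_ind: "(\<integral>\<omega>. ind c (?AB \<omega>) \<partial>M) = p * ind c (p, 0) + (1 - p) * ind c (1, p)" for c
  proof -
    have "(\<integral>\<omega>. ind c (?AB \<omega>) \<partial>M) = (\<integral>x. ind c x \<partial>distr M borel ?AB)"
      by (subst integral_distr) auto
    also have "\<dots> = (\<integral>i. ind c (?c i) \<partial>bernoulli_pmf p)"
      unfolding AB by (subst integral_distr) auto
    finally show ?thesis
      using p
      by (subst (asm) integral_measure_pmf[of UNIV])
        (simp_all add: UNIV_bool mixed_coeffs_simps scaleR_conv_of_real add.commute)
  qed
  \<comment> \<open>Equality in distribution fixes the values of \<open>(A, B)\<close> only almost
    surely.\<close>
  have AE_AB: "AE \<omega> in M. ?AB \<omega> = (p, 0) \<or> ?AB \<omega> = (1, p)"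
  proof -
    have "AE x in distr (bernoulli_pmf p) borel ?c. x \<in> {(p, 0), (1, p)}"
      by (subst AE_distr_iff) (auto intro!: AE_I2 simp: mixed_coeffs_def)
    then show ?thesis
      unfolding AB[symmetric] by (subst (asm) AE_distr_iff) auto
  qed
  have int_iexp: "integrable M (\<lambda>\<omega>. iexp (s * V \<omega>))" if "random_variable borel V" for s V
    using that by (intro integrable_iexp) auto
  \<comment> \<open>At the atom \<open>(p, 0)\<close> the variable \<open>V2\<close> drops out; the
    factor 1 keeps the three-factor shape of \<open>indep_var3_integral\<close>.\<close>
  let ?T1 = "\<lambda>\<omega>. iexp (p * t * V1 \<omega>) * 1 * ind (p, 0) (?AB \<omega>)"
  let ?T2 = "\<lambda>\<omega>. iexp (t * V1 \<omega>) * iexp (p * t * V2 \<omega>) * ind (1, p) (?AB \<omega>)"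
  have T1: "integrable M ?T1"
      "(\<integral>\<omega>. ?T1 \<omega> \<partial>M) =
        (\<integral>\<omega>. iexp (p * t * V1 \<omega>) \<partial>M) * (\<integral>\<omega>. 1 \<partial>M) * (\<integral>\<omega>. ind (p, 0) (?AB \<omega>) \<partial>M)"
    by (rule indep_var3_integral[OF indep, where f = "\<lambda>x. iexp (p * t * x)" and g = "\<lambda>_. 1",
            OF _ _ _ int_iexp[OF rv(1)] _ int_ind]; simp)+
  have T2: "integrable M ?T2"
      "(\<integral>\<omega>. ?T2 \<omega> \<partial>M) = (\<integral>\<omega>. iexp (t * V1 \<omega>) \<partial>M) *
        (\<integral>\<omega>. iexp (p * t * V2 \<omega>) \<partial>M) * (\<integral>\<omega>. ind (1, p) (?AB \<omega>) \<partial>M)"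
    by (rule indep_var3_integral[OF indep, where f = "\<lambda>x. iexp (t * x)" and g = "\<lambda>x. iexp (p * t * x)",
            OF _ _ _ int_iexp[OF rv(1)] int_iexp[OF rv(2)] int_ind]; simp)+
  have "char (distr M borel (\<lambda>\<omega>. A \<omega> * V1 \<omega> + B \<omega> * V2 \<omega>)) t =
      (\<integral>\<omega>. iexp (t * (A \<omega> * V1 \<omega> + B \<omega> * V2 \<omega>)) \<partial>M)"
    by (rule char_distr) fact
  also have "\<dots> = (\<integral>\<omega>. ?T1 \<omega> + ?T2 \<omega> \<partial>M)"
  \<comment> \<open>The atoms are distinct since \<open>p < 1\<close>, so exactly one of
    \<open>?T1\<close> and \<open>?T2\<close> survives at each: the exponent involves
    \<open>p * V1\<close> at the first and \<open>V1 + p * V2\<close> at the second.\<close>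
  proof (rule integral_cong_AE)
    show "AE \<omega> in M. iexp (t * (A \<omega> * V1 \<omega> + B \<omega> * V2 \<omega>)) = ?T1 \<omega> + ?T2 \<omega>"
      using AE_AB by eventually_elim
        (use p in \<open>auto simp: ind_def algebra_simps simp flip: exp_add\<close>)
  qed measurable
  also have "\<dots> = (\<integral>\<omega>. ?T1 \<omega> \<partial>M) + (\<integral>\<omega>. ?T2 \<omega> \<partial>M)"
    by (rule Bochner_Integration.integral_add[OF T1(1) T2(1)])
  also have "\<dots> = p * char (distr M borel V1) (p * t) +
      (1 - p) * (char (distr M borel V1) t * char (gamma_distr 1) (p * t))"
    unfolding T1(2) T2(2) E_ind V2[symmetric] char_distr[OF rv(1)] char_distr[OF rv(2)]
    using p by (simp add: ind_def prob_space)
  finally show "char (distr M borel (\<lambda>\<omega>. A \<omega> * V1 \<omega> + B \<omega> * V2 \<omega>)) t =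
      p * char (distr M borel V1) (p * t) +
      (1 - p) * (char (distr M borel V1) t * char (gamma_distr 1) (p * t))" .
qed

section \<open>The functional equation and its continuous solutions\<close>

lemma one_minus_imaginary_nonzero: "1 - \<i> * complex_of_real x \<noteq> 0"
  by (simp add: complex_eq_iff)

text \<open>Multiplying the difference of the two sides by the nonzero denominator \<open>c\<close>
  gives \<open>p\<close> times the difference of the sides of the second equation. It is used with
  \<open>a\<close> and \<open>b\<close> the values of \<open>\<phi>\<close> at \<open>t\<close> and
  \<open>p * t\<close>.\<close>

lemma rde_functional_equation:
  fixes a b :: complex and p t :: real
  assumes "0 < p"
  shows "a = p * b + (1 - p) * (a * (1 / (1 - \<i> * (p * t)))) \<longleftrightarrow>
    (1 - \<i> * t) * a = (1 - \<i> * (p * t)) * b"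
proof -
  have nz: "1 - \<i> * (p * t) \<noteq> 0"
    using one_minus_imaginary_nonzero[of "p * t"] by simp
  define c where "c = 1 - \<i> * (complex_of_real p * t)"
  have c: "c \<noteq> 0" and p: "complex_of_real p \<noteq> 0"
    using nz assms by (auto simp: c_def)
  have "c * (a - (p * b + (1 - p) * (a * (1 / c)))) = c * a - c * p * b - (1 - p) * a"
    using c by (simp add: field_simps)
  \<comment> \<open>The coefficient of \<open>a\<close> is
    \<open>c - (1 - p) = p * (1 - \<i> * t)\<close>.\<close>
  also have "\<dots> = p * ((1 - \<i> * t) * a - c * b)"
    by (simp add: c_def algebra_simps)
  finally have "a - (p * b + (1 - p) * (a * (1 / c))) = 0 \<longleftrightarrow> (1 - \<i> * t) * a - c * b = 0"
    using c p by (metis mult_eq_0_iff)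
  then show ?thesis
    by (simp add: c_def)
qed

text \<open>Along the points \<open>p ^ n * t\<close> the function is constant, yet its values
  converge to \<open>g 0\<close>; limits in a Hausdorff space are unique.\<close>

lemma isCont_scale_invariant_eq:
  fixes g :: "real \<Rightarrow> 'b::t2_space"
  assumes "isCont g 0" and "\<bar>p\<bar> < 1" and inv: "\<And>t. g t = g (p * t)"
  shows "g t = g 0"
proof -
  have "(\<lambda>n. p ^ n * t) \<longlonglongrightarrow> 0 * t"
    using assms(2) by (intro tendsto_mult tendsto_const LIMSEQ_power_zero) simp
  then have "(\<lambda>n. g (p ^ n * t)) \<longlonglongrightarrow> g 0"
    using assms(1) by (intro isCont_tendsto_compose[of 0 g]) simp_all
  moreover have "g (p ^ n * t) = g t" for n
    by (induction n) (simp_all add: mult.assoc flip: inv)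
  ultimately show ?thesis
    by (simp add: LIMSEQ_const_iff)
qed

section \<open>Characterization of the solutions\<close>

text \<open>Levy's uniqueness theorem is applied at both ends of a chain of equivalences: first to
  turn the equation between laws into one between characteristic functions, finally to recover the
  law from \<open>\<phi>\<close>. One chain thus yields both that the exponential law solves the
  equation and that no other law does.\<close>

lemma rde_solution_iff:
  assumes p: "0 < p" "p < 1" and set: "rde_setting p M V1 V2 A B"
  shows "rde_solution p M V1 V2 A B \<longleftrightarrow> distr M borel V1 = gamma_distr 1"
proof -
  interpret prob_space M using set by (simp add: rde_setting_def)
  let ?R = "\<lambda>\<omega>. A \<omega> * V1 \<omega> + B \<omega> * V2 \<omega>"
  let ?\<phi> = "char (distr M borel V1)"
  have V1 [measurable]: "random_variable borel V1"
    using set by (auto simp: rde_setting_def indep_var3_def)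
  note R = char_rde_rhs[OF p set]
  interpret V1: real_distribution "distr M borel V1"
    by (rule real_distribution_distr) fact
  interpret R: real_distribution "distr M borel ?R"
    by (rule real_distribution_distr) (rule R)
  have "rde_solution p M V1 V2 A B \<longleftrightarrow> distr M borel V1 = distr M borel ?R"
    using set R(1) by (simp add: rde_solution_def eq_in_distr_def)
  also have "\<dots> \<longleftrightarrow> ?\<phi> = char (distr M borel ?R)"
    using Levy_uniqueness[OF V1.real_distribution_axioms R.real_distribution_axioms] by auto
  also have "\<dots> \<longleftrightarrow> (\<forall>t. (1 - \<i> * t) * ?\<phi> t = (1 - \<i> * (p * t)) * ?\<phi> (p * t))"
    using rde_functional_equation[OF p(1)]
    by (simp add: fun_eq_iff R(2) char_gamma_distr_1)
  also have "\<dots> \<longleftrightarrow> (\<forall>t. (1 - \<i> * t) * ?\<phi> t = 1)" (is "?inv \<longleftrightarrow> ?one")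
  proof
    assume ?inv
    define g where "g t = (1 - \<i> * complex_of_real t) * ?\<phi> t" for t
    have "g t = g 0" for t
    proof (rule isCont_scale_invariant_eq)
      show "isCont g 0"
        unfolding g_def by (intro continuous_intros V1.isCont_char)
      show "\<bar>p\<bar> < 1" using p by simp
      show "g t = g (p * t)" for t
        using \<open>?inv\<close> by (simp add: g_def)
    qed
    then show ?one
      by (simp add: g_def V1.char_zero)
  next
    \<comment> \<open>Both sides of \<open>?inv\<close> are instances of \<open>?one\<close>, at
      \<open>t\<close> and at \<open>p * t\<close>.\<close>
    assume ?one
    then show ?inv
      by (metis of_real_mult)
  qed
  also have "\<dots> \<longleftrightarrow> ?\<phi> = char (gamma_distr 1)"
    using one_minus_imaginary_nonzero by (simp add: fun_eq_iff char_gamma_distr_1 field_simps)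
  also have "\<dots> \<longleftrightarrow> distr M borel V1 = gamma_distr 1"
    using Levy_uniqueness[OF V1.real_distribution_axioms real_distribution_gamma_distr_1] by auto
  finally show ?thesis .
qed

section \<open>Existence of a setting with exponential \<open>V1\<close>\<close>

text \<open>The product measure of a box factors. Boxes with full sides give the laws of the
  coordinates, and general boxes give their independence.\<close>

lemma indep_var3_pair_measure:
  fixes P :: "'b::topological_space measure" and Q :: "'c::topological_space measure"
    and D :: "'d::topological_space measure"
  assumes "prob_space P" "prob_space Q" "prob_space D"
    and [measurable_cong, simp]: "sets P = sets borel" "sets Q = sets borel" "sets D = sets borel"
  defines "M \<equiv> P \<Otimes>\<^sub>M (Q \<Otimes>\<^sub>M D)"
  shows "prob_space M"
    and "prob_space.indep_var3 M fst (\<lambda>\<omega>. fst (snd \<omega>)) (\<lambda>\<omega>. snd (snd \<omega>))"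
    and "distr M borel fst = P"
    and "distr M borel (\<lambda>\<omega>. fst (snd \<omega>)) = Q"
    and "distr M borel (\<lambda>\<omega>. snd (snd \<omega>)) = D"
proof -
  interpret P: prob_space P by fact
  interpret Q: prob_space Q by fact
  interpret D: prob_space D by fact
  interpret QD: pair_prob_space Q D ..
  interpret PQD: pair_prob_space P "Q \<Otimes>\<^sub>M D" ..
  have [simp]: "space P = UNIV" "space Q = UNIV" "space D = UNIV"
    using assms(4-6)[THEN sets_eq_imp_space_eq] by auto
  have [measurable_cong]: "sets M = sets (borel \<Otimes>\<^sub>M (borel \<Otimes>\<^sub>M borel))"
    unfolding M_def by (intro sets_pair_measure_cong assms)
  have spM [simp]: "space M = UNIV"
    by (simp add: M_def space_pair_measure)
  show M: "prob_space M" unfolding M_def by (rule PQD.prob_space_axioms)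
  then interpret M: prob_space M .
  have box: "emeasure M (S \<times> T \<times> U) = emeasure P S * (emeasure Q T * emeasure D U)"
    if "S \<in> sets borel" "T \<in> sets borel" "U \<in> sets borel" for S T U
    using that by (simp add: M_def QD.emeasure_pair_measure_Times D.emeasure_pair_measure_Times)
  have UNIV1 [simp]: "emeasure P UNIV = 1" "emeasure Q UNIV = 1" "emeasure D UNIV = 1"
    using P.emeasure_space_1 Q.emeasure_space_1 D.emeasure_space_1 by auto
  have box1: "emeasure M (S \<times> UNIV) = emeasure P S" if "S \<in> sets borel" for S
    using box[of S UNIV UNIV] that by simp
  have vim: "fst -` S = S \<times> UNIV \<times> UNIV" "(\<lambda>\<omega>. fst (snd \<omega>)) -` T = UNIV \<times> T \<times> UNIV"
    "(\<lambda>\<omega>. snd (snd \<omega>)) -` U = UNIV \<times> UNIV \<times> U"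
    for S :: "'b set" and T :: "'c set" and U :: "'d set"
    by auto
  show "distr M borel fst = P"
    by (rule measure_eqI) (auto simp: emeasure_distr vim box box1)
  show "distr M borel (\<lambda>\<omega>. fst (snd \<omega>)) = Q"
    by (rule measure_eqI) (auto simp: emeasure_distr vim box box1)
  show "distr M borel (\<lambda>\<omega>. snd (snd \<omega>)) = D"
    by (rule measure_eqI) (auto simp: emeasure_distr vim box box1)
  let ?F = "\<lambda>i::nat. if i = 0 then {fst -` S \<inter> space M | S. S \<in> sets borel}
         else if i = 1 then {(\<lambda>\<omega>. fst (snd \<omega>)) -` S \<inter> space M | S. S \<in> sets borel}
         else {(\<lambda>\<omega>. snd (snd \<omega>)) -` S \<inter> space M | S. S \<in> sets borel}"
  have rv: "M.random_variable borel fst" "M.random_variable borel (\<lambda>\<omega>. fst (snd \<omega>))"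
    "M.random_variable borel (\<lambda>\<omega>. snd (snd \<omega>))"
    by measurable
  have "M.indep_sets ?F {0, 1, 2}"
  \<comment> \<open>Each family contains the whole space, so the product formula need only be
    checked for the full index set.\<close>
  proof (subst M.indep_sets_finite)
    show "?F i \<subseteq> M.events" for i
      using rv[THEN measurable_sets] by auto
    show "space M \<in> ?F i" for i
      by (auto intro!: exI[of _ UNIV])
    show "\<forall>A\<in>Pi {0, 1, 2} ?F. M.prob (\<Inter>j\<in>{0, 1, 2}. A j) = (\<Prod>j\<in>{0, 1, 2}. M.prob (A j))"
    proof
      fix A assume "A \<in> Pi {0, 1, 2} ?F"
      then have "A 0 \<in> ?F 0" "A 1 \<in> ?F 1" "A 2 \<in> ?F 2" by (blast dest: PiE)+
      then obtain S T U where
        STU: "S \<in> sets borel" "T \<in> sets borel" "U \<in> sets borel"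
        and A: "A 0 = S \<times> UNIV \<times> UNIV" "A 1 = UNIV \<times> T \<times> UNIV" "A 2 = UNIV \<times> UNIV \<times> U"
        by (auto simp: vim)
      have "(\<Inter>j\<in>{0, 1, 2}. A j) = S \<times> T \<times> U"
        using A by auto
      then show "M.prob (\<Inter>j\<in>{0, 1, 2}. A j) = (\<Prod>j\<in>{0, 1, 2}. M.prob (A j))"
        using A STU by (simp add: measure_def box box1 enn2real_mult)
    qed
  qed auto
  then show "M.indep_var3 fst (\<lambda>\<omega>. fst (snd \<omega>)) (\<lambda>\<omega>. snd (snd \<omega>))"
    unfolding M.indep_var3_def using rv by blast
qed

text \<open>The witness is the product of two exponential laws and the law of the coefficient
  vector. \<open>A\<close> and \<open>B\<close> are the components of the third coordinate, which
  keeps their mutual dependence.\<close>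

lemma rde_setting_exists:
  "\<exists>(M :: (real \<times> real \<times> real \<times> real) measure) V1 V2 A B.
     rde_setting p M V1 V2 A B \<and> distr M borel V1 = gamma_distr 1"
proof -
  let ?D = "distr (bernoulli_pmf p) borel (mixed_coeffs (1 - p) p)"
  have D: "prob_space ?D"
    by (rule prob_space.prob_space_distr) (auto intro: prob_space_measure_pmf)
  have sets: "sets (gamma_distr 1) = sets borel" "sets ?D = sets borel"
    by (auto simp: gamma_distr_def)
  note M = indep_var3_pair_measure[OF prob_space_gamma_distr_1 prob_space_gamma_distr_1 D sets(1,1,2)]
  let ?M = "gamma_distr 1 \<Otimes>\<^sub>M (gamma_distr 1 \<Otimes>\<^sub>M ?D)"
  interpret prob_space ?M by (rule M)
  have "(\<lambda>\<omega>. snd (snd \<omega>)) \<in> borel_measurable ?M"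
    using M(2) by (simp add: indep_var3_def)
  then have "rde_setting p ?M fst (\<lambda>\<omega>. fst (snd \<omega>))
      (\<lambda>\<omega>. fst (snd (snd \<omega>))) (\<lambda>\<omega>. snd (snd (snd \<omega>)))"
    using M by (simp add: rde_setting_def eq_in_distr_def)
  with M(3) show ?thesis by blast
qed

text \<open>The first conjunct provides an actual solution, so the equivalence is not merely about
  an empty class of settings. The equivalence then covers every probability space on
  \<open>'a\<close>: its forward direction is uniqueness in distribution, its backward direction
  says that any exponential \<open>V1\<close> in the setting is a solution.\<close>

theorem theorem1:
  fixes p :: real
  assumes "0 < p" and "p < 1"
  shows "(\<exists>(M :: (real \<times> real \<times> real \<times> real) measure) V1 V2 A B.
            rde_solution p M V1 V2 A B \<and> distr M borel V1 = gamma_distr 1) \<and>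
         (\<forall>(M :: 'a measure) V1 V2 A B.
            rde_setting p M V1 V2 A B \<longrightarrow>
            (rde_solution p M V1 V2 A B \<longleftrightarrow> distr M borel V1 = gamma_distr 1))"
proof (intro conjI allI impI)
  show "\<exists>(M :: (real \<times> real \<times> real \<times> real) measure) V1 V2 A B.
      rde_solution p M V1 V2 A B \<and> distr M borel V1 = gamma_distr 1"
    using rde_setting_exists[of p] rde_solution_iff[OF assms] by blast
qed (rule rde_solution_iff[OF assms])

end
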